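(* Let $X$ be a normed space, let $F\subset X$ be a closed, bounded, convex set containing the origin as an interior point, let $\Omega_1,\ldots,\Omega_n\subset X$ ($n\ge 1$) be nonempty closed bounded sets, and let $\Omega\subset X$ be a nonempty closed set. Let $\bar x\in\Omega$ and $r\ge 0$. Then $\bar x$ is a solution of the optimization problem $$\text{minimize } C(x)=\max\{C_F(x;\Omega_i): i=1,\ldots,n\}\quad\text{subject to } x\in\Omega$$ with $r=C(\bar x)$ if and only if $\bar x$ is a solution of the smallest enclosing ball problem with smallest radius $r$.
   Context: For a nonempty bounded set $Q\subset X$ and $x\in X$, the maximal time function is $C_F(x;Q)=\inf\{t\ge 0: Q\subset x+tF\}$. A solution of the optimization problem is a point $\bar x\in\Omega$ with $C(\bar x)\le C(x)$ for all $x\in\Omega$. A point $\bar x\in\Omega$ is a solution of the smallest enclosing ball problem with smallest radius $r\ge 0$ if $\Omega_i\subset\bar x+rF$ for all $i=1,\ldots,n$, and for any $x\in\Omega$ and $t\ge 0$ such that $\Omega_i\subset x+tF$ for all $i=1,\ldots,n$, one has $r\le t$. *)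

theory Defs
  imports "HOL-Analysis.Analysis"
begin

text \<open>The generalized ball \<open>x + tF\<close>; for \<open>t = 0\<close> it is \<open>{x}\<close> when \<open>F\<close> is nonempty.\<close>

definition gen_ball :: "'a::real_normed_vector set \<Rightarrow> 'a \<Rightarrow> real \<Rightarrow> 'a set" where
  "gen_ball F x t = (+) x ` ((*\<^sub>R) t ` F)"

text \<open>The maximal time function \<open>C\<^sub>F(x; Q)\<close>. The infimum is that of the reals, so it carries
  its usual meaning only if some \<open>t \<ge> 0\<close> is admissible, as is the case when \<open>Q\<close> is bounded and
  \<open>0\<close> is an interior point of \<open>F\<close>.\<close>

definition max_time :: "'a::real_normed_vector set \<Rightarrow> 'a set \<Rightarrow> 'a \<Rightarrow> real" where
  "max_time F Q x = Inf {t. 0 \<le> t \<and> Q \<subseteq> gen_ball F x t}"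

text \<open>The targets \<open>\<Omega>\<^sub>1, \<dots>, \<Omega>\<^sub>n\<close> are given by \<open>Qs 1, \<dots>, Qs n\<close>; other values of \<open>Qs\<close> are ignored.\<close>

definition max_time_cost ::
  "'a::real_normed_vector set \<Rightarrow> nat \<Rightarrow> (nat \<Rightarrow> 'a set) \<Rightarrow> 'a \<Rightarrow> real" where
  "max_time_cost F n Qs x = Max ((\<lambda>i. max_time F (Qs i) x) ` {1..n})"

definition minimization_solution :: "('a \<Rightarrow> real) \<Rightarrow> 'a set \<Rightarrow> 'a \<Rightarrow> bool" where
  "minimization_solution C S xb \<longleftrightarrow> xb \<in> S \<and> (\<forall>x\<in>S. C xb \<le> C x)"

definition smallest_enclosing_ball_solution ::
  "'a::real_normed_vector set \<Rightarrow> nat \<Rightarrow> (nat \<Rightarrow> 'a set) \<Rightarrow> 'a set \<Rightarrow> 'a \<Rightarrow> real \<Rightarrow> bool" where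
  "smallest_enclosing_ball_solution F n Qs S xb r \<longleftrightarrow>
     xb \<in> S \<and> 0 \<le> r \<and> (\<forall>i\<in>{1..n}. Qs i \<subseteq> gen_ball F xb r) \<and>
     (\<forall>x\<in>S. \<forall>t\<ge>0. (\<forall>i\<in>{1..n}. Qs i \<subseteq> gen_ball F x t) \<longrightarrow> r \<le> t)"

end

theory Submission
  imports Defs
begin

text \<open>The admissible radii \<open>t \<ge> 0\<close> with \<open>Q \<subseteq> x + tF\<close> form a nonempty, upward closed and
  topologically closed set, so \<open>Q \<subseteq> x + tF\<close> holds exactly if \<open>C\<^sub>F(x; Q) \<le> t\<close>. Hence both
  problems ask for the least \<open>t\<close> that bounds \<open>C\<close> at some point of \<open>\<Omega>\<close>.\<close>

lemma mem_gen_ball_iff: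
  assumes "t > 0"
  shows "q \<in> gen_ball F x t \<longleftrightarrow> (q - x) /\<^sub>R t \<in> F"
proof
  assume "q \<in> gen_ball F x t"
  then show "(q - x) /\<^sub>R t \<in> F"
    using assms by (auto simp: gen_ball_def)
next
  assume "(q - x) /\<^sub>R t \<in> F"
  moreover have "q = x + t *\<^sub>R ((q - x) /\<^sub>R t)"
    using assms by simp
  ultimately show "q \<in> gen_ball F x t"
    unfolding gen_ball_def by blast
qed

text \<open>Rescaling from \<open>s\<close> to \<open>t\<close> replaces \<open>f\<close> by
  \<open>(s / t) *\<^sub>R f\<close>, a convex combination of \<open>f\<close> and the
  origin.\<close>

lemma gen_ball_mono:
  assumes "convex F" "0 \<in> F" "0 \<le> s" "s \<le> t"
  shows "gen_ball F x s \<subseteq> gen_ball F x t"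
proof
  fix q assume "q \<in> gen_ball F x s"
  then obtain f where f: "f \<in> F" "q = x + s *\<^sub>R f"
    by (auto simp: gen_ball_def)
  have "(s / t) *\<^sub>R f \<in> F"
    using convexD[OF assms(1) f(1) assms(2), of "s / t" "1 - s / t"] assms(3,4)
    \<comment> \<open>For \<open>t = 0\<close> also \<open>s = 0\<close>, and division by zero gives
      \<open>s / t = 0\<close>, so the point is the origin.\<close>
    by (cases "t = 0") (auto simp: divide_le_eq_1 assms(2))
  moreover have "q = x + t *\<^sub>R ((s / t) *\<^sub>R f)"
    using f(2) assms(3,4) by (cases "t = 0") auto
  ultimately show "q \<in> gen_ball F x t"
    unfolding gen_ball_def by blast
qed

text \<open>If \<open>F\<close> contains the ball of radius \<open>e\<close> about 0 and
  \<open>Q\<close> lies within distance \<open>B\<close> of \<open>x\<close>, then scaling by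
  \<open>B / e\<close> stretches that ball to radius \<open>B\<close>.\<close>

lemma gen_ball_exhausts:
  assumes "0 \<in> interior F" "bounded Q"
  obtains t where "t > 0" "Q \<subseteq> gen_ball F x t"
proof -
  obtain e where e: "e > 0" "cball 0 e \<subseteq> F"
    using assms(1) by (auto simp: mem_interior_cball)
  have "bounded ((\<lambda>q. q - x) ` Q)"
    using bounded_translation[OF assms(2), of "- x"] by simp
  then obtain B where B: "B > 0" "\<And>q. q \<in> Q \<Longrightarrow> norm (q - x) \<le> B"
    by (auto simp: bounded_pos)
  have "q \<in> gen_ball F x (B / e)" if "q \<in> Q" for q
  proof -
    have "norm ((q - x) /\<^sub>R (B / e)) = e * norm (q - x) / B"
      using B(1) e(1) by simp
    also have "\<dots> \<le> e"
      using B(1) B(2)[OF that] e(1) by (simp add: divide_le_eq)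
    finally have "(q - x) /\<^sub>R (B / e) \<in> cball 0 e"
      by simp
    then show ?thesis
      using B(1) e mem_gen_ball_iff[of "B / e" q F x] by auto
  qed
  then show thesis
    using that[of "B / e"] B(1) e(1) by auto
qed

text \<open>For \<open>m > 0\<close> the points \<open>(q - x) /\<^sub>R t\<close> of
  \<open>F\<close> tend to \<open>(q - x) /\<^sub>R m\<close> as \<open>t\<close> decreases to
  \<open>m\<close>, and \<open>F\<close> is closed. For \<open>m = 0\<close> this quotient is of no
  use; instead boundedness of \<open>F\<close> shrinks the balls to \<open>x\<close>.\<close>

lemma gen_ball_closed_radius:
  assumes "closed F" "bounded F" "0 \<in> F" "m \<ge> 0"
    and q: "\<And>t. t > m \<Longrightarrow> q \<in> gen_ball F x t"
  shows "q \<in> gen_ball F x m"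
proof (cases "m = 0")
  case True
  obtain B where B: "B > 0" "\<And>f. f \<in> F \<Longrightarrow> norm f \<le> B"
    using assms(2) by (auto simp: bounded_pos)
  have "norm (q - x) \<le> 0 + e" if "e > 0" for e
  proof -
    \<comment> \<open>Since \<open>B\<close> bounds the norms in \<open>F\<close>, the ball of
      radius \<open>e / B\<close> stays within distance \<open>e\<close> of
      \<open>x\<close>.\<close>
    have "q \<in> gen_ball F x (e / B)"
      using q True that B(1) by simp
    then obtain f where "f \<in> F" "q = x + (e / B) *\<^sub>R f"
      by (auto simp: gen_ball_def)
    then show ?thesis
      using that B(1) B(2)[of f] by (simp add: field_simps)
  qed
  then have "norm (q - x) \<le> 0"
    by (rule field_le_epsilon)
  then show ?thesis
    using True assms(3) by (auto simp: gen_ball_def)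
next
  case False
  then have m: "m > 0"
    using assms(4) by simp
  have "((\<lambda>t. (q - x) /\<^sub>R t) \<longlongrightarrow> (q - x) /\<^sub>R m) (at_right m)"
    using m by (intro tendsto_intros) auto
  moreover have "\<forall>\<^sub>F t in at_right m. (q - x) /\<^sub>R t \<in> F"
    unfolding eventually_at_right_field
  proof (intro exI[of _ "m + 1"] conjI allI impI)
    fix t assume "m < t"
    then show "(q - x) /\<^sub>R t \<in> F"
      using q m mem_gen_ball_iff[of t q F x] by auto
  qed simp
  ultimately have "(q - x) /\<^sub>R m \<in> F"
    by (intro Lim_in_closed_set[OF assms(1)]) auto
  then show ?thesis
    using m by (simp add: mem_gen_ball_iff)
qed

context
  fixes F :: "'a::real_normed_vector set"
  assumes F: "closed F" "bounded F" "convex F" "0 \<in> interior F"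
begin

text \<open>This makes the infimum in \<open>max_time\<close> a genuine one and permits the rules
  for conditionally complete orders.\<close>

lemma admissible_radii_nonempty:
  assumes "bounded Q"
  shows "{t. 0 \<le> t \<and> Q \<subseteq> gen_ball F x t} \<noteq> {}"
proof -
  obtain t where "t > 0" "Q \<subseteq> gen_ball F x t"
    using gen_ball_exhausts[OF F(4) assms] .
  then have "t \<in> {t. 0 \<le> t \<and> Q \<subseteq> gen_ball F x t}"
    by simp
  then show ?thesis
    by blast
qed

lemma max_time_nonneg:
  assumes "bounded Q"
  shows "0 \<le> max_time F Q x"
  unfolding max_time_def
proof (rule cInf_greatest)
  show "{t. 0 \<le> t \<and> Q \<subseteq> gen_ball F x t} \<noteq> {}"
    by (rule admissible_radii_nonempty[OF assms])
qed simp

lemma max_time_le_iff: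
  assumes "bounded Q" "t \<ge> 0"
  shows "max_time F Q x \<le> t \<longleftrightarrow> Q \<subseteq> gen_ball F x t"
proof
  let ?T = "{t. 0 \<le> t \<and> Q \<subseteq> gen_ball F x t}"
  have zero: "0 \<in> F"
    using F(4) interior_subset by blast
  have bdd: "bdd_below ?T"
    by (rule bdd_belowI[of _ 0]) simp
  show "max_time F Q x \<le> t" if "Q \<subseteq> gen_ball F x t"
    unfolding max_time_def using that assms(2) bdd by (intro cInf_lower) auto
  have ne: "?T \<noteq> {}"
    by (rule admissible_radii_nonempty[OF assms(1)])
  show "Q \<subseteq> gen_ball F x t" if le: "max_time F Q x \<le> t"
  proof
    fix q assume "q \<in> Q"
    show "q \<in> gen_ball F x t"
    \<comment> \<open>The infimum need not be known to be attained: every \<open>u > t\<close>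
      exceeds some admissible \<open>s\<close>, so \<open>q\<close> lies in the ball of radius
      \<open>u\<close> by monotonicity, and closedness passes to \<open>t\<close>.\<close>
    proof (rule gen_ball_closed_radius[OF F(1,2) zero assms(2)])
      fix u assume "u > t"
      then have "Inf ?T < u"
        using le by (simp add: max_time_def)
      then obtain s where "s \<in> ?T" "s < u"
        using cInf_less_iff[OF ne bdd] by blast
      then show "q \<in> gen_ball F x u"
        using gen_ball_mono[OF F(3) zero, of s u x] \<open>q \<in> Q\<close> by auto
    qed
  qed
qed

lemma max_time_cost_nonneg:
  assumes "n \<ge> 1" "\<And>i. i \<in> {1..n} \<Longrightarrow> bounded (Qs i)"
  shows "0 \<le> max_time_cost F n Qs x"
proof -
  have "0 \<le> max_time F (Qs 1) x"
    using assms by (intro max_time_nonneg) auto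
  also have "\<dots> \<le> max_time_cost F n Qs x"
    unfolding max_time_cost_def using assms(1) by (intro Max_ge) auto
  finally show ?thesis .
qed

lemma max_time_cost_le_iff:
  assumes "n \<ge> 1" "\<And>i. i \<in> {1..n} \<Longrightarrow> bounded (Qs i)" "t \<ge> 0"
  shows "max_time_cost F n Qs x \<le> t \<longleftrightarrow> (\<forall>i\<in>{1..n}. Qs i \<subseteq> gen_ball F x t)"
proof -
  have "max_time_cost F n Qs x \<le> t \<longleftrightarrow> (\<forall>i\<in>{1..n}. max_time F (Qs i) x \<le> t)"
    unfolding max_time_cost_def using assms(1) by (subst Max_le_iff) auto
  also have "\<dots> \<longleftrightarrow> (\<forall>i\<in>{1..n}. Qs i \<subseteq> gen_ball F x t)"
    using max_time_le_iff assms(2,3) by (intro ball_cong) auto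
  finally show ?thesis .
qed

end

theorem proposition2p5:
  fixes F S :: "'a::real_normed_vector set"
    and Qs :: "nat \<Rightarrow> 'a set"
    and n :: nat
    and xb :: 'a
    and r :: real
  assumes "closed F" and "bounded F" and "convex F" and "0 \<in> interior F"
    and "n \<ge> 1"
    and "\<And>i. i \<in> {1..n} \<Longrightarrow> Qs i \<noteq> {}"
    and "\<And>i. i \<in> {1..n} \<Longrightarrow> closed (Qs i)"
    and "\<And>i. i \<in> {1..n} \<Longrightarrow> bounded (Qs i)"
    and "S \<noteq> {}" and "closed S"
    and "xb \<in> S" and "r \<ge> 0"
  shows "minimization_solution (max_time_cost F n Qs) S xb \<and> r = max_time_cost F n Qs xb
    \<longleftrightarrow> smallest_enclosing_ball_solution F n Qs S xb r"
proof -
  let ?C = "max_time_cost F n Qs"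
  have nonneg: "0 \<le> ?C x" for x
    by (rule max_time_cost_nonneg) (use assms(1-5,8) in auto)
  have le_iff: "(\<forall>i\<in>{1..n}. Qs i \<subseteq> gen_ball F x t) \<longleftrightarrow> ?C x \<le> t" if "t \<ge> 0" for x t
    by (rule max_time_cost_le_iff[symmetric]) (use assms(1-5,8) that in auto)
  have "smallest_enclosing_ball_solution F n Qs S xb r \<longleftrightarrow>
      ?C xb \<le> r \<and> (\<forall>x\<in>S. \<forall>t\<ge>0. ?C x \<le> t \<longrightarrow> r \<le> t)"
    using assms(11,12) by (simp add: smallest_enclosing_ball_solution_def le_iff del: One_nat_def)
  \<comment> \<open>The least \<open>t\<close> allowed at \<open>x\<close> is \<open>?C x\<close>
    itself, which is a legitimate radius because it is nonnegative.\<close>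
  also have "\<dots> \<longleftrightarrow> ?C xb \<le> r \<and> (\<forall>x\<in>S. r \<le> ?C x)"
    using nonneg by (meson order.trans order.refl)
  \<comment> \<open>Taking \<open>x = xb\<close> in the lower bound gives
    \<open>r \<le> ?C xb\<close>, hence equality.\<close>
  also have "\<dots> \<longleftrightarrow> minimization_solution ?C S xb \<and> r = ?C xb"
    unfolding minimization_solution_def using assms(11) by (metis order.antisym order.refl order.trans)
  finally show ?thesis
    by blast
qed

end
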